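(* Let $b\ge3$ be an integer and let $K$ be the set of numbers in $[0,1]$ having a base-$b$ expansion using only the digits $0$ and $1$. Let $\gamma=(1+\sqrt5)/2$. Assume $\Psi:\mathbb{N}\to\mathbb{R}_{>0}$ satisfies: there is $\epsilon>0$ with $\Psi(x)<x^{-\gamma-\epsilon}$ for all sufficiently large $x$, and $\Psi(lx)\le l\Psi(x)$ for all $l,x\in\mathbb{N}$. Then the set $$\Big(\mathscr{K}_1(\Psi)\setminus\bigcup_{c<\frac{1}{b-1}}\mathscr{K}_1(c\Psi)\Big)\cap K$$ is uncountable. The same holds with $\mathscr{K}_1$ replaced by $\mathscr{K}_1^{\ast}$, and then the condition $\Psi(lx)\le l\Psi(x)$ may be dropped.
   Context: $\mathbb{N}=\{1,2,\dots\}$; $\mathscr{K}_1(\Psi)=\{\zeta\in\mathbb{R}\setminus\mathbb{Q}:|\zeta q-p|\le\Psi(q)$ for infinitely many $(q,p)\in\mathbb{N}\times\mathbb{Z}\}$, and $\mathscr{K}_1^{\ast}(\Psi)$ is the same counting only pairs with $\gcd(q,p)=1$. The union is over all real $c<1/(b-1)$. *)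

theory Defs
  imports Complex_Main "HOL-Library.Countable_Set"
begin

definition K1 :: "(nat \<Rightarrow> real) \<Rightarrow> real set" where
  "K1 \<Psi> = {\<zeta>. \<zeta> \<notin> \<rat> \<and>
     infinite {(q :: nat, p :: int). q \<ge> 1 \<and> \<bar>\<zeta> * real q - real_of_int p\<bar> \<le> \<Psi> q}}"

definition K1_star :: "(nat \<Rightarrow> real) \<Rightarrow> real set" where
  "K1_star \<Psi> = {\<zeta>. \<zeta> \<notin> \<rat> \<and>
     infinite {(q :: nat, p :: int). q \<ge> 1 \<and> gcd (int q) p = 1 \<and>
       \<bar>\<zeta> * real q - real_of_int p\<bar> \<le> \<Psi> q}}"

(* The digit of weight b^(-n) with n \<ge> 1 is a (n - 1). *)
definition digits01_set :: "nat \<Rightarrow> real set" where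
  "digits01_set b = {x. 0 \<le> x \<and> x \<le> 1 \<and>
     (\<exists>a :: nat \<Rightarrow> nat. (\<forall>n. a n \<in> {0, 1}) \<and> (\<lambda>n. real (a n) / real b ^ (n + 1)) sums x)}"

end

theory Submission
  imports Defs "HOL-Real_Asymp.Real_Asymp"
begin

text \<open>
  Build \<open>\<zeta>\<close> in blocks of base-\<open>b\<close> digits. If the first \<open>n\<close> digits are fixed and \<open>q = b ^ n\<close>, append a run of
  zeros whose length is dictated by \<open>\<Psi> q\<close>, then a word of slowly growing length \<open>L\<close>, then a free
  digit and a \<open>1\<close>. With the word \<open>10...0\<close> or \<open>11...1\<close>, depending on where \<open>\<Psi> q\<close> lies between two
  powers of \<open>b\<close>, the error at \<open>q\<close> is at most \<open>\<Psi> q\<close> and at least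
  \<open>(1 - o(1)) * \<Psi> q / (b - 1)\<close>. The final \<open>1\<close> makes the truncation a reduced fraction, and the block
  positions do not depend on the free digits, which therefore give uncountably many \<open>\<zeta>\<close>.

  A reduced fraction \<open>p / x\<close> that is no truncation differs from each truncation by at least the
  reciprocal of the product of the denominators. If \<open>q < q'\<close> are the truncation denominators such that
  \<open>2 * x\<close> lies between the inverse errors at \<open>q\<close> and at \<open>q'\<close>, this gives
  \<open>\<bar>\<zeta> * x - p\<bar> \<ge> 1 / (2 * q')\<close>. Up to sub-power factors, \<open>q'\<close> is \<open>q\<close> times the inverse error at \<open>q\<close>,
  hence at most \<open>q * x\<close>, while \<open>q ^ \<gamma>\<close> is at most \<open>x\<close>. So \<open>q'\<close> is at most \<open>x\<close> to the
  power \<open>1 + 1 / \<gamma> = \<gamma>\<close>, and \<open>p / x\<close> does not approximate to within \<open>\<Psi> x\<close>.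
\<close>

section \<open>Exact approximation order from a sequence of good approximations\<close>

lemma finite_approximations_bounded_denominator:
  fixes \<zeta> :: real
  shows "finite {(q :: nat, p :: int). q < Q \<and> \<bar>\<zeta> * real q - real_of_int p\<bar> \<le> \<Psi> q}"
proof (rule finite_subset)
  show "{(q :: nat, p :: int). q < Q \<and> \<bar>\<zeta> * real q - real_of_int p\<bar> \<le> \<Psi> q} \<subseteq>
     (SIGMA q:{..<Q}. {\<lfloor>\<zeta> * real q - \<Psi> q\<rfloor>..\<lceil>\<zeta> * real q + \<Psi> q\<rceil>})"
    by (auto simp: floor_le_iff le_ceiling_iff)
qed auto

lemma coprime_fraction_unique:
  fixes q q' :: nat and p p' :: int
  assumes "gcd (int q) p = 1" "gcd (int q') p' = 1" "int q * p' = p * int q'"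
  shows "q = q'" and "q \<ge> 1 \<Longrightarrow> p = p'"
proof -
  have "int q dvd int q'" "int q' dvd int q"
    using assms by (metis coprime_dvd_mult_right_iff coprime_iff_gcd_eq_1 dvd_triv_left,
      metis coprime_dvd_mult_left_iff coprime_iff_gcd_eq_1 dvd_triv_right)
  then show "q = q'" by (simp add: dvd_antisym)
  then show "p = p'" if "q \<ge> 1" using assms(3) that by (simp add: mult.commute)
qed

lemma golden_ratio_bounds:
  fixes g :: real
  defines "g \<equiv> (1 + sqrt 5) / 2"
  shows "g > 1" "g \<le> 2" "1 / g = g - 1"
proof -
  have "sqrt 5 > sqrt 1" "sqrt 5 \<le> sqrt (3^2)" by (simp_all only: real_sqrt_less_iff real_sqrt_le_iff) auto
  then show *: "g > 1" "g \<le> 2" unfolding g_def by simp_all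
  have "g * g = g + 1" unfolding g_def by (simp add: field_simps)
  then show "1 / g = g - 1" using * by (simp add: field_simps)
qed

text \<open>If \<zeta> = u / v, every error times v is an integer, so a positive error is at least 1
  / v and the errors cannot tend to 0.\<close>

lemma not_in_Rats_if_approx:
  fixes \<zeta> :: real and q :: "nat \<Rightarrow> nat" and p :: "nat \<Rightarrow> int"
  assumes pos: "\<And>k. \<bar>\<zeta> * real (q k) - real_of_int (p k)\<bar> > 0"
    and lim: "(\<lambda>k. \<bar>\<zeta> * real (q k) - real_of_int (p k)\<bar>) \<longlonglongrightarrow> 0"
  shows "\<zeta> \<notin> \<rat>"
proof
  assume "\<zeta> \<in> \<rat>"
  then obtain u v :: int where v: "v > 0" and z: "\<zeta> = of_int u / of_int v"
    by (metis Rats_cases')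
  obtain k where k: "\<bar>\<zeta> * real (q k) - real_of_int (p k)\<bar> < 1 / of_int v"
    using order_tendstoD(2)[OF lim, of "1 / of_int v"] v by (auto simp: eventually_sequentially)
  have eq: "\<bar>\<zeta> * real (q k) - real_of_int (p k)\<bar> * of_int v = of_int \<bar>u * int (q k) - p k * v\<bar>"
  proof -
    have "\<bar>\<zeta> * real (q k) - real_of_int (p k)\<bar> * of_int v
      = \<bar>(\<zeta> * real (q k) - real_of_int (p k)) * of_int v\<bar>" using v by (simp add: abs_mult)
    also have "(\<zeta> * real (q k) - real_of_int (p k)) * of_int v = of_int (u * int (q k) - p k * v)"
      using v z by (simp add: field_simps)
    finally show ?thesis by simp
  qed
  have "of_int \<bar>u * int (q k) - p k * v\<bar> < (1::real)"
    using k v unfolding eq[symmetric] by (simp add: field_simps)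
  moreover have "of_int \<bar>u * int (q k) - p k * v\<bar> > (0::real)"
    unfolding eq[symmetric] using pos[of k] v by simp
  ultimately show False by (simp del: of_int_abs)
qed

text \<open>Exactness has two sources. At the given fractions, \<open>\<theta>_ge\<close> and the
  limit of \<open>\<kappa>\<close> exclude every factor c below \<open>\<kappa>\<^sub>0\<close>. At
  all other coprime pairs with large denominator, \<open>q_Suc\<close> and the sub-power bound on
  \<open>C\<close> exclude even the factor 1.\<close>

lemma exact_approximation_star:
  fixes \<zeta> \<epsilon> \<kappa>\<^sub>0 :: real and q :: "nat \<Rightarrow> nat" and p :: "nat \<Rightarrow> int"
    and \<Psi> :: "nat \<Rightarrow> real" and \<kappa> C :: "nat \<Rightarrow> real"
  defines "g \<equiv> (1 + sqrt 5) / 2"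
  defines "\<theta> \<equiv> \<lambda>k. \<bar>\<zeta> * real (q k) - real_of_int (p k)\<bar>"
  assumes \<Psi>: "\<And>x. x \<ge> 1 \<Longrightarrow> \<Psi> x > 0"
    and \<epsilon>: "\<epsilon> > 0" and decay: "\<And>x. x \<ge> N \<Longrightarrow> \<Psi> x < real x powr (- g - \<epsilon>)"
    and q: "\<And>k. q k \<ge> 1" "strict_mono q"
    and coprime: "\<And>k. gcd (int (q k)) (p k) = 1"
    and \<theta>_pos: "\<And>k. \<theta> k > 0"
    and \<theta>_le: "\<And>k. \<theta> k \<le> \<Psi> (q k)"
    and \<theta>_ge: "\<And>k. \<kappa> k * \<Psi> (q k) \<le> \<theta> k"
    and \<kappa>: "\<kappa> \<longlonglongrightarrow> \<kappa>\<^sub>0" "\<kappa>\<^sub>0 \<le> 1"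
    and q_Suc: "\<And>k. real (q (Suc k)) * \<theta> k \<le> C k * real (q k)"
    and C: "\<And>\<eta>. \<eta> > 0 \<Longrightarrow> eventually (\<lambda>k. C k \<le> real (q k) powr \<eta>) sequentially"
  shows "\<zeta> \<in> K1_star \<Psi> - (\<Union>c\<in>{c. c < \<kappa>\<^sub>0}. K1_star (\<lambda>q. c * \<Psi> q))"
proof -
  have g: "g > 1" "g \<le> 2" "1 / g = g - 1" using golden_ratio_bounds unfolding g_def by auto
  have q_real: "real (q k) \<ge> 1" for k using q(1)[of k] by simp
  have q_N: "eventually (\<lambda>k. q k \<ge> N) sequentially"
    using filterlim_subseq[OF q(2)] by (simp add: filterlim_at_top)
  have \<theta>_lim: "\<theta> \<longlonglongrightarrow> 0"
  proof (rule tendsto_sandwich[OF _ _ tendsto_const])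
    show "eventually (\<lambda>k. 0 \<le> \<theta> k) sequentially" using \<theta>_pos by (simp add: less_imp_le)
    show "eventually (\<lambda>k. \<theta> k \<le> 1 / real (q k)) sequentially"
      using q_N
    proof eventually_elim
      case (elim k)
      have "\<theta> k \<le> real (q k) powr (- g - \<epsilon>)" using \<theta>_le[of k] decay[OF elim] by simp
      also have "\<dots> \<le> real (q k) powr (- 1)" using g \<epsilon> q_real by (intro powr_mono) auto
      also have "\<dots> = 1 / real (q k)" using q_real[of k] by (simp add: powr_minus_divide)
      finally show ?case .
    qed
    show "(\<lambda>k. 1 / real (q k)) \<longlonglongrightarrow> 0"
      using LIMSEQ_subseq_LIMSEQ[OF lim_inverse_n q(2)] by (simp add: o_def inverse_eq_divide)
  qed
  have irrat: "\<zeta> \<notin> \<rat>"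
    using not_in_Rats_if_approx[of \<zeta> q p] \<theta>_pos \<theta>_lim unfolding \<theta>_def by blast
  have inf: "infinite {(q :: nat, p :: int). q \<ge> 1 \<and> gcd (int q) p = 1 \<and>
       \<bar>\<zeta> * real q - real_of_int p\<bar> \<le> \<Psi> q}" (is "infinite ?S")
  proof
    assume "finite ?S"
    moreover have "range (\<lambda>k. (q k, p k)) \<subseteq> ?S"
      using q(1) coprime \<theta>_le unfolding \<theta>_def by auto
    moreover have "inj (\<lambda>k. (q k, p k))"
      using strict_mono_imp_inj_on[OF q(2)] by (auto simp: inj_on_def)
    ultimately show False using finite_subset range_inj_infinite by blast
  qed
  have "\<zeta> \<notin> K1_star (\<lambda>q. c * \<Psi> q)" if c: "c < \<kappa>\<^sub>0" for c
  proof -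
    have "eventually (\<lambda>k. C k \<le> real (q k) powr (\<epsilon> / 2) \<and> \<kappa> k > c \<and> q k \<ge> N) sequentially"
      using C[of "\<epsilon> / 2"] \<epsilon> order_tendstoD(1)[OF \<kappa>(1) c] q_N by (auto intro: eventually_conj)
    then obtain k1 where k1: "\<And>k. k \<ge> k1 \<Longrightarrow> C k \<le> real (q k) powr (\<epsilon> / 2) \<and> \<kappa> k > c \<and> q k \<ge> N"
      by (auto simp: eventually_sequentially)
    \<comment> \<open>\<open>N\<close> makes the decay bound available at denominators from
      \<open>Q\<close> on. The bound 1 / (2 * \<theta> k1) forces the index \<open>k\<close> chosen
      below to lie past \<open>k1\<close>, so that it has a predecessor. The last entry contradicts
      the inequality z powr (\<epsilon> / 2) < 8 * 2 powr (\<epsilon> / 2) reached at the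
      end.\<close>
    obtain Q :: nat where Q: "real Q \<ge> max (max 1 (real N)) (max (1 / (2 * \<theta> k1)) ((8 * 2 powr (\<epsilon> / 2)) powr (2 / \<epsilon>)))"
      using real_arch_simple by blast
    have no: "\<not> \<bar>\<zeta> * real x - real_of_int y\<bar> \<le> c * \<Psi> x"
      if x: "x \<ge> Q" and xy: "gcd (int x) y = 1" for x :: nat and y :: int
    proof
      define X where "X = \<bar>\<zeta> * real x - real_of_int y\<bar>"
      assume "\<bar>\<zeta> * real x - real_of_int y\<bar> \<le> c * \<Psi> x"
      then have X: "X \<le> c * \<Psi> x" unfolding X_def .
      have xQ: "real x \<ge> real Q" using x by simp
      have x1: "real x \<ge> 1" and "real x \<ge> real N" using xQ Q by linarith+
      then have xN: "x \<ge> N" by simp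
      have "c * \<Psi> x \<le> \<Psi> x" using \<Psi>[of x] x1 c \<kappa>(2) by simp
      then have X_less: "X < real x powr (- g - \<epsilon>)" using X decay[OF xN] by linarith
      define k where "k = (LEAST k. k \<ge> k1 \<and> real x * \<theta> k < 1 / 2)"
      have "eventually (\<lambda>k. \<theta> k < 1 / (2 * real x) \<and> k \<ge> k1) sequentially"
        using order_tendstoD(2)[OF \<theta>_lim, of "1 / (2 * real x)"] x1 eventually_ge_at_top[of k1]
        by (auto intro: eventually_conj)
      then obtain k' where "\<theta> k' < 1 / (2 * real x)" "k' \<ge> k1"
        by (auto simp: eventually_sequentially)
      then have "k' \<ge> k1 \<and> real x * \<theta> k' < 1 / 2" using x1 by (simp add: field_simps)
      then have k: "k \<ge> k1" "real x * \<theta> k < 1 / 2" unfolding k_def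
        using LeastI[of "\<lambda>k. k \<ge> k1 \<and> real x * \<theta> k < 1 / 2"] by blast+
      have "real x \<ge> 1 / (2 * \<theta> k1)" using xQ Q by linarith
      then have "real x * \<theta> k1 \<ge> 1 / 2" using \<theta>_pos[of k1] by (simp add: field_simps)
      then have "k \<noteq> k1" using k(2) by auto
      then obtain j where j: "k = Suc j" "j \<ge> k1" using k(1) by (cases k) auto
      have j2: "real x * \<theta> j \<ge> 1 / 2"
        using not_less_Least[of j "\<lambda>k. k \<ge> k1 \<and> real x * \<theta> k < 1 / 2"] j unfolding k_def[symmetric] by force
      show False
      proof (cases "int x * p k = y * int (q k)")
        \<comment> \<open>The pair is the approximation (q k, p k) itself; here
          \<open>\<kappa> k > c\<close> decides.\<close>
        case True
        then have "x = q k" "y = p k" using coprime_fraction_unique[OF xy coprime] x1 by auto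
        then have "\<kappa> k * \<Psi> (q k) \<le> c * \<Psi> (q k)" using X \<theta>_ge[of k] unfolding X_def \<theta>_def by simp
        moreover have "\<Psi> (q k) > 0" using \<Psi> q by simp
        ultimately show False using k1[OF k(1)] by simp
      next
        case False
        \<comment> \<open>A nonzero determinant is at least 1 in absolute value. Written through the
          two errors, its summand \<open>x * \<theta> k\<close> is below 1/2, so
          \<open>q k * X\<close> exceeds 1/2.\<close>
        then have "\<bar>int x * p k - y * int (q k)\<bar> \<ge> 1" by linarith
        then have "1 \<le> \<bar>real_of_int (int x * p k - y * int (q k))\<bar>" by linarith
        also have "real_of_int (int x * p k - y * int (q k)) =
            real (q k) * (\<zeta> * real x - real_of_int y) - real x * (\<zeta> * real (q k) - real_of_int (p k))"
          by (simp add: algebra_simps)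
        also have "\<bar>\<dots>\<bar> \<le> real (q k) * X + real x * \<theta> k"
          unfolding X_def \<theta>_def by (rule order_trans[OF abs_triangle_ineq4]) (simp add: abs_mult)
        finally have qX: "real (q k) * X > 1 / 2" using k(2) by linarith
        define z where "z = real x"
        define w where "w = real (q j)"
        have z1: "z \<ge> 1" and w1: "w \<ge> 1" using x1 q_real unfolding z_def w_def by auto
        have "real (q k) * X \<le> real (q k) * z powr (- g - \<epsilon>)"
          using X_less q_real[of k] unfolding z_def by (intro mult_left_mono) auto
        then have "1 / 2 < real (q k) * z powr (- g - \<epsilon>)" using qX by linarith
        also have "z powr (- g - \<epsilon>) = 1 / z powr (g + \<epsilon>)"
          using powr_minus_divide[of z "g + \<epsilon>"] by simp
        finally have up: "z powr (g + \<epsilon>) < 2 * real (q k)" using z1 by (simp add: field_simps)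
        have "real (q k) * \<theta> j \<le> C j * w" using q_Suc[of j] j unfolding w_def by simp
        then have "real (q k) * \<theta> j * (2 * z) \<le> C j * w * (2 * z)" using z1 by (intro mult_right_mono) auto
        moreover have "real (q k) * (2 * (z * \<theta> j)) \<ge> real (q k) * 1"
          using j2 q_real[of k] unfolding z_def by (intro mult_left_mono) auto
        ultimately have qk: "real (q k) \<le> C j * w * (2 * z)" by (simp add: algebra_simps)
        have "\<theta> j \<le> w powr (- g - \<epsilon>)" using \<theta>_le[of j] decay[of "q j"] k1[of j] j unfolding w_def by simp
        also have "\<dots> \<le> w powr (- g)" using w1 \<epsilon> by (intro powr_mono) auto
        also have "\<dots> = 1 / w powr g" by (simp add: powr_minus_divide)
        finally have "z * \<theta> j \<le> z * (1 / w powr g)" using z1 by (intro mult_left_mono) auto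
        then have "1 / 2 \<le> z * (1 / w powr g)" using j2 unfolding z_def by linarith
        then have wg: "w powr g \<le> 2 * z" using w1 by (simp add: field_simps)
        have "w = (w powr g) powr (1 / g)" using w1 g(1) by (simp add: powr_powr)
        also have "\<dots> \<le> (2 * z) powr (1 / g)" using wg g by (intro powr_mono2) auto
        finally have wz: "w \<le> (2 * z) powr (g - 1)" using g by simp
        also have "\<dots> \<le> (2 * z) powr 1" using g z1 by (intro powr_mono) auto
        finally have wz1: "w \<le> 2 * z" using z1 by simp
        have "C j \<le> w powr (\<epsilon> / 2)" using k1[OF j(2)] unfolding w_def by simp
        also have "\<dots> \<le> (2 * z) powr (\<epsilon> / 2)" using wz1 w1 \<epsilon> by (intro powr_mono2) auto
        finally have Cj: "C j \<le> (2 * z) powr (\<epsilon> / 2)" .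
        \<comment> \<open>The golden ratio enters here: w is at most 2 * z to the power 1 / g = g -
          1, so the exponents add up to \<epsilon> / 2 + (g - 1) + 1 = g + \<epsilon> / 2. This
          falls \<epsilon> / 2 short of the exponent in \<open>up\<close>. The constant 8 is the
          factor 2 of \<open>up\<close> times 2 powr 2, which bounds 2 powr g.\<close>
        have "real (q k) \<le> (2 * z) powr (\<epsilon> / 2) * (2 * z) powr (g - 1) * (2 * z)"
          using qk Cj wz w1 z1 by (elim order_trans) (intro mult_mono, auto)
        also have "\<dots> = (2 * z) powr (\<epsilon> / 2) * (2 * z) powr g"
          using z1 by (simp add: powr_diff)
        also have "\<dots> = 2 powr (\<epsilon> / 2) * 2 powr g * (z powr (\<epsilon> / 2) * z powr g)"
          using z1 by (simp add: powr_mult)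
        also have "\<dots> \<le> 2 powr (\<epsilon> / 2) * 2 powr 2 * (z powr (\<epsilon> / 2) * z powr g)"
          using g by (intro mult_right_mono mult_left_mono powr_mono) auto
        finally have "z powr (g + \<epsilon>) < 8 * 2 powr (\<epsilon> / 2) * (z powr (\<epsilon> / 2) * z powr g)"
          using up by simp
        moreover have "z powr (g + \<epsilon>) = z powr (\<epsilon> / 2) * (z powr (\<epsilon> / 2) * z powr g)"
          by (simp add: powr_add[symmetric] add.commute)
        moreover have "z powr (\<epsilon> / 2) * z powr g > 0" using z1 by simp
        ultimately have lt: "z powr (\<epsilon> / 2) < 8 * 2 powr (\<epsilon> / 2)"
          by (simp only: mult_less_cancel_right_disj) linarith
        have "8 * 2 powr (\<epsilon> / 2) = ((8 * 2 powr (\<epsilon> / 2)) powr (2 / \<epsilon>)) powr (\<epsilon> / 2)"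
          using \<epsilon> by (simp add: powr_powr)
        also have "\<dots> \<le> z powr (\<epsilon> / 2)" using xQ Q \<epsilon> unfolding z_def by (intro powr_mono2) auto
        finally show False using lt by linarith
      qed
    qed
    have "{(q :: nat, p :: int). q \<ge> 1 \<and> gcd (int q) p = 1 \<and> \<bar>\<zeta> * real q - real_of_int p\<bar> \<le> c * \<Psi> q}
        \<subseteq> {(q, p). q < Q \<and> \<bar>\<zeta> * real q - real_of_int p\<bar> \<le> c * \<Psi> q}"
      using no by (auto simp: not_le[symmetric])
    then have "finite {(q :: nat, p :: int). q \<ge> 1 \<and> gcd (int q) p = 1 \<and> \<bar>\<zeta> * real q - real_of_int p\<bar> \<le> c * \<Psi> q}"
      by (rule finite_subset) (rule finite_approximations_bounded_denominator)
    then show ?thesis unfolding K1_star_def by simp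
  qed
  then show ?thesis using irrat inf by (auto simp: K1_star_def)
qed

section \<open>Passing from arbitrary pairs to coprime pairs\<close>

text \<open>Dividing a pair by its gcd l divides the error by l, and \<open>mult\<close> keeps the
  reduced pair within \<Psi>. A single reduced pair accounts for only finitely many pairs, because
  its multiples by l have l times its positive error while \<Psi> is eventually at most 1. So
  infinitely many pairs reduce to infinitely many coprime ones.\<close>

lemma K1_subset_K1_star:
  fixes \<Psi> :: "nat \<Rightarrow> real"
  assumes mult: "\<And>l x. l \<ge> 1 \<Longrightarrow> x \<ge> 1 \<Longrightarrow> \<Psi> (l * x) \<le> real l * \<Psi> x"
    and bd: "\<And>x. x \<ge> N \<Longrightarrow> \<Psi> x \<le> 1"
  shows "K1 \<Psi> \<subseteq> K1_star \<Psi>"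
proof
  fix \<zeta> assume z: "\<zeta> \<in> K1 \<Psi>"
  define A where "A = {(q :: nat, p :: int). q \<ge> 1 \<and> \<bar>\<zeta> * real q - real_of_int p\<bar> \<le> \<Psi> q}"
  define B where "B = {(q :: nat, p :: int). q \<ge> 1 \<and> gcd (int q) p = 1 \<and> \<bar>\<zeta> * real q - real_of_int p\<bar> \<le> \<Psi> q}"
  have irr: "\<zeta> \<notin> \<rat>" and inf: "infinite A" using z by (auto simp: K1_def A_def)
  define F where "F r = {(l * fst r, int l * snd r) | l :: nat. l \<ge> 1 \<and> \<bar>\<zeta> * real (l * fst r) - real_of_int (int l * snd r)\<bar> \<le> \<Psi> (l * fst r)}"
    for r :: "nat \<times> int"
  have fin: "finite (F r)" if r: "r \<in> B" for r
  proof -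
    obtain x y where xy: "r = (x, y)" "x \<ge> 1" using r by (auto simp: B_def)
    define X where "X = \<bar>\<zeta> * real x - real_of_int y\<bar>"
    have "\<zeta> * real x \<noteq> real_of_int y"
    proof
      assume "\<zeta> * real x = real_of_int y"
      then have "\<zeta> = real_of_int y / real x" using xy by (simp add: field_simps)
      then show False using irr by simp
    qed
    then have X: "X > 0" unfolding X_def by simp
    have "l \<le> max N (nat \<lceil>1 / X\<rceil>)" if l: "\<bar>\<zeta> * real (l * x) - real_of_int (int l * y)\<bar> \<le> \<Psi> (l * x)" for l
    proof (cases "l \<le> N")
      case False
      have "\<zeta> * real (l * x) - real_of_int (int l * y) = real l * (\<zeta> * real x - real_of_int y)"
        by (simp add: algebra_simps)
      then have "real l * X \<le> \<Psi> (l * x)" using l unfolding X_def by (simp add: abs_mult)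
      also have "l * 1 \<le> l * x" using xy by (intro mult_left_mono) auto
      then have "l * x \<ge> N" using False by linarith
      then have "\<Psi> (l * x) \<le> 1" by (rule bd)
      finally have "real l \<le> 1 / X" using X by (simp add: field_simps)
      then show ?thesis by linarith
    qed simp
    then have "F r \<subseteq> (\<lambda>l. (l * x, int l * y)) ` {..max N (nat \<lceil>1 / X\<rceil>)}"
      unfolding F_def xy(1) by auto
    then show ?thesis by (rule finite_subset) simp
  qed
  have sub: "A \<subseteq> (\<Union>r\<in>B. F r)"
  proof
    fix r assume r: "r \<in> A"
    then obtain q p where qp: "r = (q, p)" "q \<ge> 1" "\<bar>\<zeta> * real q - real_of_int p\<bar> \<le> \<Psi> q" by (auto simp: A_def)
    define l where "l = nat (gcd (int q) p)"
    have l: "l \<ge> 1" "int l = gcd (int q) p" using qp(2) unfolding l_def by (auto simp: Suc_le_eq)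
    define x where "x = q div l"
    define y where "y = p div int l"
    have "int l dvd int q" "int l dvd p" using l by auto
    then have q: "q = l * x" and p: "p = int l * y" unfolding x_def y_def by auto
    have x: "x \<ge> 1" using q qp(2) by (cases x) auto
    have "int l * gcd (int x) y = gcd (int q) p"
      unfolding q p using gcd_mult_distrib_int[of "int l" "int x" y] by simp
    then have cop: "gcd (int x) y = 1" using l qp(2) by auto
    have "real l * \<bar>\<zeta> * real x - real_of_int y\<bar> = \<bar>\<zeta> * real q - real_of_int p\<bar>"
    proof -
      have "\<zeta> * real q - real_of_int p = real l * (\<zeta> * real x - real_of_int y)"
        by (simp add: q p algebra_simps)
      then show ?thesis by (simp add: abs_mult)
    qed
    also have "\<dots> \<le> real l * \<Psi> x" using qp(3) mult[OF l(1) x] q by simp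
    finally have "\<bar>\<zeta> * real x - real_of_int y\<bar> \<le> \<Psi> x" using l by simp
    then have "(x, y) \<in> B" using x cop by (simp add: B_def)
    moreover have "r \<in> F (x, y)" using qp q p l(1) unfolding F_def by auto
    ultimately show "r \<in> (\<Union>r\<in>B. F r)" by blast
  qed
  have "infinite B"
  proof
    assume "finite B"
    then have "finite (\<Union>r\<in>B. F r)" using fin by blast
    then show False using inf sub finite_subset by blast
  qed
  then show "\<zeta> \<in> K1_star \<Psi>" using irr by (simp add: K1_star_def B_def)
qed

section \<open>Expansions with digits 0 and 1\<close>

definition base_value :: "nat \<Rightarrow> (nat \<Rightarrow> nat) \<Rightarrow> real" where
  "base_value b a = (\<Sum>n. real (a n) / real b ^ (n + 1))"

text \<open>The numerator of the truncation after n digits over the denominator b^n, kept as an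
  integer for the coprimality argument.\<close>

fun base_prefix :: "nat \<Rightarrow> (nat \<Rightarrow> nat) \<Rightarrow> nat \<Rightarrow> nat" where
  "base_prefix b a 0 = 0"
| "base_prefix b a (Suc n) = b * base_prefix b a n + a n"

context
  fixes b :: nat
  assumes b: "b \<ge> 3"
begin

lemma geometric_base_sums: "(\<lambda>n. 1 / real b ^ (n + 1)) sums (1 / (real b - 1))"
proof -
  have "(\<lambda>n. 1 / real b * (1 / real b) ^ n) sums (1 / real b * (1 / (1 - 1 / real b)))"
    using b by (intro sums_mult geometric_sums) auto
  then show ?thesis using b by (simp add: field_simps power_one_over)
qed

lemma base_value_sums:
  assumes "\<And>n. a n \<le> (1::nat)"
  shows "(\<lambda>n. real (a n) / real b ^ (n + 1)) sums base_value b a"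
proof -
  have "summable (\<lambda>n. real (a n) / real b ^ (n + 1))"
    using assms sums_summable[OF geometric_base_sums]
    by (elim summable_comparison_test'[of _ 0]) (auto intro!: divide_right_mono simp: le_Suc_eq)
  then show ?thesis unfolding base_value_def by (rule summable_sums)
qed

lemma base_value_bounds:
  assumes "\<And>n. a n \<le> (1::nat)"
  shows "0 \<le> base_value b a" "base_value b a \<le> 1 / (real b - 1)"
proof -
  show "0 \<le> base_value b a"
    by (rule sums_le[OF _ sums_zero base_value_sums[of a, OF assms]]) simp
  show "base_value b a \<le> 1 / (real b - 1)"
  proof (rule sums_le[OF _ base_value_sums[of a, OF assms] geometric_base_sums])
    show "real (a n) / real b ^ (n + 1) \<le> 1 / real b ^ (n + 1)" for n
      using assms[of n] by (intro divide_right_mono) auto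
  qed
qed

lemma base_value_split:
  assumes "\<And>n. a n \<le> (1::nat)"
  shows "base_value b a = (\<Sum>i<n. real (a i) / real b ^ (i + 1)) + base_value b (\<lambda>i. a (i + n)) / real b ^ n"
proof -
  have s: "(\<lambda>i. real (a (i + n)) / real b ^ (i + 1)) sums base_value b (\<lambda>i. a (i + n))"
    using assms by (intro base_value_sums)
  have "(\<lambda>i. real (a (i + n)) / real b ^ (i + n + 1)) sums (base_value b (\<lambda>i. a (i + n)) / real b ^ n)"
    using sums_divide[OF s, of "real b ^ n"] by (simp add: power_add field_simps)
  from sums_iff_shift[THEN iffD1, OF this[unfolded add.assoc[symmetric]]]
  have "(\<lambda>i. real (a i) / real b ^ (i + 1)) sums
      (base_value b (\<lambda>i. a (i + n)) / real b ^ n + (\<Sum>i<n. real (a i) / real b ^ (i + 1)))"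
    by simp
  from sums_unique2[OF base_value_sums[of a, OF assms] this] show ?thesis by (simp add: add.commute)
qed

lemma base_prefix_eq: "real (base_prefix b a n) = real b ^ n * (\<Sum>i<n. real (a i) / real b ^ (i + 1))"
  using b by (induction n) (auto simp: algebra_simps)

text \<open>This turns approximation into digits: the error at the denominator b^n is the number
  whose expansion is the remaining digits.\<close>

lemma base_value_prefix:
  assumes "\<And>n. a n \<le> (1::nat)"
  shows "base_value b a * real (b ^ n) - real (base_prefix b a n) = base_value b (\<lambda>i. a (i + n))"
  using b by (subst base_value_split[of a n, OF assms]) (simp_all add: base_prefix_eq algebra_simps)

lemma base_value_Suc:
  assumes "\<And>n. a n \<le> (1::nat)"
  shows "base_value b a = (real (a 0) + base_value b (\<lambda>i. a (Suc i))) / real b"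
  by (subst base_value_split[of a 1, OF assms]) (simp add: add_divide_distrib)

text \<open>Tails are at most 1 / (b - 1), hence at most 1/2 since b is at least 3, and cannot make
  up for a difference of 1 in the leading digit. In base 2 they could.\<close>

lemma base_value_inject_0:
  assumes "\<And>n. a n \<le> (1::nat)" "\<And>n. a' n \<le> (1::nat)" "base_value b a = base_value b a'"
  shows "a 0 = a' 0"
proof -
  have bd: "0 \<le> base_value b (\<lambda>i. c (Suc i))" "base_value b (\<lambda>i. c (Suc i)) \<le> 1 / 2"
    if "\<And>n. c n \<le> (1::nat)" for c
  proof -
    have "1 / (real b - 1) \<le> 1 / 2" using b by (intro divide_left_mono) auto
    then show "0 \<le> base_value b (\<lambda>i. c (Suc i))" "base_value b (\<lambda>i. c (Suc i)) \<le> 1 / 2"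
      using base_value_bounds[of "\<lambda>i. c (Suc i)", OF that] by linarith+
  qed
  have "real (a 0) + base_value b (\<lambda>i. a (Suc i)) = real (a' 0) + base_value b (\<lambda>i. a' (Suc i))"
    using assms(3) b unfolding base_value_Suc[of a, OF assms(1)] base_value_Suc[of a', OF assms(2)] by simp
  then have "\<bar>real (a 0) - real (a' 0)\<bar> \<le> 1 / 2"
    using bd[of a, OF assms(1)] bd[of a', OF assms(2)] by linarith
  then show ?thesis by linarith
qed

lemma base_value_inject:
  assumes "\<And>n. a n \<le> (1::nat)" "\<And>n. a' n \<le> (1::nat)" "base_value b a = base_value b a'"
  shows "a n = a' n"
  using assms
proof (induction n arbitrary: a a')
  case (0 a a')
  then show ?case by (rule base_value_inject_0)
next
  case (Suc n a a')
  have "a 0 = a' 0" using Suc.prems by (rule base_value_inject_0)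
  moreover have "(real (a 0) + base_value b (\<lambda>i. a (Suc i))) / real b = (real (a' 0) + base_value b (\<lambda>i. a' (Suc i))) / real b"
    using Suc.prems(3) unfolding base_value_Suc[of a, OF Suc.prems(1)] base_value_Suc[of a', OF Suc.prems(2)] .
  ultimately have "base_value b (\<lambda>i. a (Suc i)) = base_value b (\<lambda>i. a' (Suc i))"
    using b by simp
  then show ?case by (intro Suc.IH[of "\<lambda>i. a (Suc i)" "\<lambda>i. a' (Suc i)"] Suc.prems)
qed

lemma base_value_in_digits01_set:
  assumes "\<And>n. a n \<le> (1::nat)"
  shows "base_value b a \<in> digits01_set b"
proof -
  have "1 / (real b - 1) \<le> 1" using b by simp
  moreover have "a n \<in> {0, 1}" for n using assms[of n] by auto
  ultimately show ?thesis
    unfolding digits01_set_def mem_Collect_eq using base_value_bounds[of a] base_value_sums[of a] assms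
    by (intro conjI exI[of _ a]) auto
qed

end

section \<open>The block construction\<close>

text \<open>Multiply by b^G, so that the expansion starts with its first 1 and must be compared with
  \<open>Y\<close>. The word 10...0 gives a value from 1 / b up to the lower limit of
  \<open>Y\<close>; the word 11...1 gives one between (1 - b^(-L)) / (b - 1) and 1 / (b - 1), used
  only if \<open>Y\<close> is at least that large. The ratio to \<open>Y\<close> is smallest for
  11...1 with \<open>Y\<close> near 1. For 10...0, \<open>Y\<close> is below 1 / (b - 1), and (b -
  1)^2 \<ge> b suffices.\<close>

lemma block_base_value_bounds:
  fixes a :: "nat \<Rightarrow> nat" and b G L :: nat and \<psi> :: real
  defines "Y \<equiv> \<psi> * real b ^ G"
  assumes b: "b \<ge> 3" and a: "\<And>n. a n \<le> 1" and L: "L \<ge> 1"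
    and Y: "Y > 1 / real b + 1 / (real b ^ L * (real b - 1))"
      "Y \<le> 1 + real b / (real b ^ L * (real b - 1))"
    and zero: "\<And>i. i < G \<Longrightarrow> a i = 0" and one: "a G = 1"
    and block: "\<And>i. G < i \<Longrightarrow> i < G + L \<Longrightarrow> a i = (if Y \<ge> 1 / (real b - 1) then 1 else 0)"
  shows "base_value b a \<le> \<psi>"
    and "(1 - 1 / real b ^ L) / (1 + real b / real b ^ L) / (real b - 1) * \<psi> \<le> base_value b a"
    and "1 / real b ^ (G + 1) \<le> base_value b a"
    and "base_value b a \<le> 1 / real b ^ G"
proof -
  define u where "u = base_value b (\<lambda>i. a (i + G))"
  define w where "w = base_value b (\<lambda>i. a (i + L + G))"
  define d where "d = 1 / real b ^ L"
  define B where "B = real b"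
  have B: "B \<ge> 3" using b unfolding B_def by simp
  have d: "0 < d" "d \<le> 1" using B unfolding d_def B_def by auto
  have V: "base_value b a = u / real b ^ G"
    unfolding u_def by (subst base_value_split[of b a G, OF b a]) (simp add: zero)
  have uw: "u = (\<Sum>i<L. real (a (i + G)) / real b ^ (i + 1)) + w * d"
    unfolding u_def w_def d_def using a by (subst base_value_split[of b "\<lambda>i. a (i + G)" L, OF b]) auto
  have w: "0 \<le> w" "w \<le> 1 / (B - 1)" unfolding w_def B_def using a by (auto intro!: base_value_bounds[OF b])
  have wd: "0 \<le> w * d" "w * d \<le> d / (B - 1)" using w d B mult_right_mono[OF w(2), of d] by auto
  have u_le: "u \<le> 1 / (B - 1)" unfolding u_def B_def using a by (auto intro!: base_value_bounds[OF b])
  have Y1: "Y > 1 / B + d / (B - 1)" and Y2: "Y \<le> 1 + B * d / (B - 1)"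
    using Y unfolding d_def B_def by (simp_all add: field_simps)
  have "B * d / (B - 1) \<le> B * d / 1" using B d by (intro divide_left_mono) auto
  then have Y3: "Y \<le> 1 + B * d" using Y2 by simp
  have Bd: "1 + B * d > 0" using B d by (simp add: add_pos_nonneg)
  have *: "u \<le> Y \<and> (1 - d) / (1 + B * d) / (B - 1) * Y \<le> u \<and> 1 / B \<le> u"
  proof (cases "Y \<ge> 1 / (B - 1)")
    case True
    have "(\<Sum>i<L. real (a (i + G)) / real b ^ (i + 1)) = (\<Sum>i<L. (1 / B) * (1 / B) ^ i)"
    proof (rule sum.cong[OF refl])
      fix i assume "i \<in> {..<L}"
      then have "a (i + G) = 1" using one block[of "i + G"] True unfolding B_def by (cases "i = 0") auto
      then show "real (a (i + G)) / real b ^ (i + 1) = 1 / B * (1 / B) ^ i"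
        unfolding B_def by (simp add: field_simps)
    qed
    also have "\<dots> = (1 / B) * ((1 - (1 / B) ^ L) / (1 - 1 / B))"
      unfolding sum_distrib_left[symmetric] using B by (subst sum_gp_strict) auto
    also have "\<dots> = (1 - d) / (B - 1)" unfolding d_def using B by (simp add: B_def field_simps)
    finally have u: "u = (1 - d) / (B - 1) + w * d" using uw by simp
    have "(1 - d) / (1 + B * d) / (B - 1) * Y \<le> (1 - d) / (1 + B * d) / (B - 1) * (1 + B * d)"
      using Y3 d B by (intro mult_left_mono) auto
    also have "\<dots> = (1 - d) / (B - 1)" using Bd by simp
    finally have lower: "(1 - d) / (1 + B * d) / (B - 1) * Y \<le> u" using u wd by linarith
    have "d \<le> 1 / B" unfolding d_def B_def using b L by (intro divide_left_mono self_le_power) auto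
    then have "(1 - 1 / B) / (B - 1) \<le> (1 - d) / (B - 1)" using B by (intro divide_right_mono) auto
    moreover have "(1 - 1 / B) / (B - 1) = 1 / B" using B by (simp add: field_simps)
    ultimately have "1 / B \<le> u" using u wd by linarith
    then show ?thesis using lower u_le True by linarith
  next
    case False
    have "(\<Sum>i<L. real (a (i + G)) / real b ^ (i + 1)) = (\<Sum>i<L. if i = 0 then 1 / B else 0)"
    proof (rule sum.cong[OF refl])
      fix i assume "i \<in> {..<L}"
      then show "real (a (i + G)) / real b ^ (i + 1) = (if i = 0 then 1 / B else 0)"
        using one block[of "i + G"] False unfolding B_def by (cases "i = 0") auto
    qed
    also have "\<dots> = 1 / B" using L by (simp add: sum.delta)
    finally have u: "u = 1 / B + w * d" using uw by simp
    have "0 < 1 / B" "0 < d / (B - 1)" using B d by auto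
    then have "Y > 0" using Y1 by linarith
    have "(1 - d) / (1 + B * d) \<le> 1" using Bd d B by (simp add: field_simps add_pos_nonneg)
    then have "(1 - d) / (1 + B * d) / (B - 1) * Y \<le> 1 / (B - 1) * (1 / (B - 1))"
      using False B d \<open>Y > 0\<close> by (intro mult_mono divide_right_mono) auto
    also have "\<dots> \<le> 1 / B"
    proof -
      have "3 * B \<le> B * B" using B by (intro mult_right_mono) auto
      then have "B \<le> (B - 1) * (B - 1)" by (simp add: algebra_simps)
      then have "1 / ((B - 1) * (B - 1)) \<le> 1 / B"
        using B by (intro divide_left_mono mult_pos_pos) (simp_all add: algebra_simps)
      then show ?thesis by simp
    qed
    finally show ?thesis using u wd Y1 by auto
  qed
  have bG: "real b ^ G > 0" using b by simp
  show "base_value b a \<le> \<psi>" using * bG unfolding V Y_def by (simp add: field_simps)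
  show "(1 - 1 / real b ^ L) / (1 + real b / real b ^ L) / (real b - 1) * \<psi> \<le> base_value b a"
  proof -
    have "(1 - d) / (1 + B * d) / (B - 1) * \<psi> * real b ^ G \<le> u" using * unfolding Y_def by (simp add: mult.assoc)
    then show ?thesis using bG unfolding V d_def B_def by (simp add: pos_le_divide_eq)
  qed
  show "1 / real b ^ (G + 1) \<le> base_value b a" using * bG unfolding V B_def by (simp add: field_simps)
  have "1 / (B - 1) \<le> 1" using B by simp
  then have "u \<le> 1" using u_le by linarith
  then show "base_value b a \<le> 1 / real b ^ G" using bG unfolding V by (simp add: divide_right_mono)
qed

text \<open>The threshold is the largest value that the word 10...0 of length L can reach with any
  digits 0 and 1 after it.\<close>

definition block_gap :: "nat \<Rightarrow> real \<Rightarrow> nat \<Rightarrow> nat" where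
  "block_gap b \<psi> L = (LEAST G. \<psi> * real b ^ G > 1 / real b + 1 / (real b ^ L * (real b - 1)))"

text \<open>By minimality the scaled value exceeds the threshold by a factor of at most b. For a gap
  of 0 the upper bound comes from \<psi> \<le> 1 instead.\<close>

lemma block_gap:
  fixes b L :: nat and \<psi> :: real
  assumes b: "b \<ge> 3" and \<psi>: "0 < \<psi>" "\<psi> \<le> 1"
  shows "\<psi> * real b ^ block_gap b \<psi> L > 1 / real b + 1 / (real b ^ L * (real b - 1))"
    and "\<psi> * real b ^ block_gap b \<psi> L \<le> 1 + real b / (real b ^ L * (real b - 1))"
proof -
  define l where "l = 1 / real b + 1 / (real b ^ L * (real b - 1))"
  obtain G where "real b ^ G > l / \<psi>" using real_arch_pow[of "real b" "l / \<psi>"] b by auto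
  then have "\<psi> * real b ^ G > l" using \<psi> by (simp add: field_simps)
  then have G: "\<psi> * real b ^ block_gap b \<psi> L > l" unfolding block_gap_def l_def by (rule LeastI)
  then show "\<psi> * real b ^ block_gap b \<psi> L > 1 / real b + 1 / (real b ^ L * (real b - 1))" unfolding l_def .
  have bl: "real b * l = 1 + real b / (real b ^ L * (real b - 1))" unfolding l_def using b by (simp add: algebra_simps)
  show "\<psi> * real b ^ block_gap b \<psi> L \<le> 1 + real b / (real b ^ L * (real b - 1))"
  proof (cases "block_gap b \<psi> L")
    case 0
    have "0 \<le> real b / (real b ^ L * (real b - 1))" using b by simp
    then show ?thesis using 0 \<psi> by simp
  next
    case (Suc G)
    then have "\<not> \<psi> * real b ^ G > l" unfolding block_gap_def l_def using not_less_Least by (metis lessI)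
    then have "real b * (\<psi> * real b ^ G) \<le> real b * l" by (intro mult_left_mono) auto
    then show ?thesis unfolding bl Suc by (simp add: algebra_simps)
  qed
qed

section \<open>Digit sequences indexed by sets of natural numbers\<close>

text \<open>Block k has word length k + 1; with the free digit and the final 1 this makes the k + 3
  digits after the gap.\<close>

fun block_start :: "nat \<Rightarrow> (nat \<Rightarrow> real) \<Rightarrow> nat \<Rightarrow> nat \<Rightarrow> nat" where
  "block_start b \<Psi> n\<^sub>0 0 = n\<^sub>0"
| "block_start b \<Psi> n\<^sub>0 (Suc k) = block_start b \<Psi> n\<^sub>0 k
     + block_gap b (\<Psi> (b ^ block_start b \<Psi> n\<^sub>0 k)) (Suc k) + k + 3"

text \<open>Positions, relative to the start of a block, of its digits \<open>1\<close>; the bit \<open>s\<close> is the free digit.\<close>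

definition block_word :: "nat \<Rightarrow> real \<Rightarrow> nat \<Rightarrow> bool \<Rightarrow> nat set" where
  "block_word b \<psi> L s = (let G = block_gap b \<psi> L in
     {G, G + L + 1} \<union> (if \<psi> * real b ^ G \<ge> 1 / (real b - 1) then {G..<G + L} else {})
     \<union> (if s then {G + L} else {}))"

text \<open>At most one k qualifies, as the blocks are disjoint. The positions before
  \<open>n\<^sub>0\<close> belong to no block and get the digit 0.\<close>

definition block_digit :: "nat \<Rightarrow> (nat \<Rightarrow> real) \<Rightarrow> nat \<Rightarrow> nat set \<Rightarrow> nat \<Rightarrow> nat" where
  "block_digit b \<Psi> n\<^sub>0 S m = (if \<exists>k. block_start b \<Psi> n\<^sub>0 k \<le> m \<and> m < block_start b \<Psi> n\<^sub>0 (Suc k) \<and>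
     m - block_start b \<Psi> n\<^sub>0 k \<in> block_word b (\<Psi> (b ^ block_start b \<Psi> n\<^sub>0 k)) (Suc k) (k \<in> S) then 1 else 0)"

lemma block_digit_le_1: "block_digit b \<Psi> n\<^sub>0 S m \<le> 1"
  by (simp add: block_digit_def)

lemma strict_mono_block_start: "strict_mono (block_start b \<Psi> n\<^sub>0)"
  by (simp add: strict_mono_Suc_iff)

lemma block_digit_eq:
  fixes b n\<^sub>0 k :: nat and \<Psi> :: "nat \<Rightarrow> real"
  defines "n \<equiv> block_start b \<Psi> n\<^sub>0 k"
  assumes i: "n + i < block_start b \<Psi> n\<^sub>0 (Suc k)"
  shows "block_digit b \<Psi> n\<^sub>0 S (i + n) = (if i \<in> block_word b (\<Psi> (b ^ n)) (Suc k) (k \<in> S) then 1 else 0)"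
proof -
  have "j = k" if "block_start b \<Psi> n\<^sub>0 j \<le> i + n" "i + n < block_start b \<Psi> n\<^sub>0 (Suc j)" for j
  proof -
    have "block_start b \<Psi> n\<^sub>0 j < block_start b \<Psi> n\<^sub>0 (Suc k)" using that i by simp
    then have "j < Suc k" using strict_mono_less[OF strict_mono_block_start] by blast
    moreover have "block_start b \<Psi> n\<^sub>0 k < block_start b \<Psi> n\<^sub>0 (Suc j)" using that unfolding n_def by simp
    then have "k < Suc j" using strict_mono_less[OF strict_mono_block_start] by blast
    ultimately show ?thesis by simp
  qed
  then have "(\<exists>j. block_start b \<Psi> n\<^sub>0 j \<le> i + n \<and> i + n < block_start b \<Psi> n\<^sub>0 (Suc j) \<and> Q j) \<longleftrightarrow> Q k" for Q
    using i unfolding n_def by (metis add.commute le_add1)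
  then show ?thesis unfolding block_digit_def n_def by simp
qed

lemma block_number_exact:
  fixes b n\<^sub>0 N :: nat and \<Psi> :: "nat \<Rightarrow> real" and \<epsilon> :: real and S :: "nat set"
  assumes b: "b \<ge> 3" and \<Psi>: "\<And>x. x \<ge> 1 \<Longrightarrow> \<Psi> x > 0" and \<epsilon>: "\<epsilon> > 0"
    and decay: "\<And>x. x \<ge> N \<Longrightarrow> \<Psi> x < real x powr (- ((1 + sqrt 5) / 2) - \<epsilon>)"
    and n\<^sub>0: "n\<^sub>0 \<ge> 1" "b ^ n\<^sub>0 \<ge> N"
  shows "base_value b (block_digit b \<Psi> n\<^sub>0 S) \<in>
    K1_star \<Psi> - (\<Union>c\<in>{c. c < 1 / (real b - 1)}. K1_star (\<lambda>q. c * \<Psi> q))"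
proof -
  define a where "a = block_digit b \<Psi> n\<^sub>0 S"
  define n where "n = block_start b \<Psi> n\<^sub>0"
  define G where "G k = block_gap b (\<Psi> (b ^ n k)) (Suc k)" for k
  define V where "V k = base_value b (\<lambda>i. a (i + n k))" for k
  define \<kappa> where "\<kappa> L = (1 - 1 / real b ^ L) / (1 + real b / real b ^ L) / (real b - 1)" for L
  have a: "a m \<le> 1" for m unfolding a_def by (rule block_digit_le_1)
  have n_Suc: "n (Suc k) = n k + G k + k + 3" for k unfolding n_def G_def by simp
  have n_mono: "strict_mono n" unfolding n_def by (rule strict_mono_block_start)
  have digit: "a (i + n k) = (if i \<in> block_word b (\<Psi> (b ^ n k)) (Suc k) (k \<in> S) then 1 else 0)"
    if "i < G k + k + 3" for i k
    using block_digit_eq[of b \<Psi> n\<^sub>0 k i S] that n_Suc[of k] unfolding a_def n_def by simp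
  have \<Psi>_less: "\<Psi> (b ^ n k) < 1 / real b ^ n k" for k
  proof -
    have "n\<^sub>0 \<le> n k" using strict_mono_leD[OF n_mono, of 0 k] by (simp add: n_def)
    then have "b ^ n\<^sub>0 \<le> b ^ n k" using b by (intro power_increasing) auto
    then have "\<Psi> (b ^ n k) < real (b ^ n k) powr (- ((1 + sqrt 5) / 2) - \<epsilon>)"
      using n\<^sub>0 by (intro decay) linarith
    also have "\<dots> \<le> real (b ^ n k) powr (- 1)"
      by (rule powr_mono) (use b \<epsilon> golden_ratio_bounds(1) in \<open>linarith, simp\<close>)
    also have "\<dots> = 1 / real b ^ n k" using b by (simp add: powr_minus_divide)
    finally show ?thesis .
  qed
  have \<Psi>_pos: "\<Psi> (b ^ n k) > 0" for k using \<Psi>[of "b ^ n k"] b by simp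
  have \<Psi>_le: "\<Psi> (b ^ n k) \<le> 1" for k
  proof -
    have "1 / real b ^ n k \<le> 1" using b by simp
    then show ?thesis using \<Psi>_less[of k] by linarith
  qed
  have V: "V k \<le> \<Psi> (b ^ n k)" "\<kappa> (Suc k) * \<Psi> (b ^ n k) \<le> V k"
     "1 / real b ^ (G k + 1) \<le> V k" "V k \<le> 1 / real b ^ G k" for k
  proof -
    note gap = block_gap[OF b \<Psi>_pos[of k] \<Psi>_le[of k], where L = "Suc k", folded G_def]
    have zero: "a (i + n k) = 0" if "i < G k" for i
      using digit[of i k] that by (simp add: block_word_def Let_def flip: G_def)
    have one: "a (G k + n k) = 1"
      using digit[of "G k" k] by (simp add: block_word_def Let_def flip: G_def)
    have block: "a (i + n k) = (if \<Psi> (b ^ n k) * real b ^ G k \<ge> 1 / (real b - 1) then 1 else 0)"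
      if "G k < i" "i < G k + Suc k" for i
      using digit[of i k] that by (simp add: block_word_def Let_def flip: G_def)
    note bounds = block_base_value_bounds[of b "\<lambda>i. a (i + n k)" "Suc k" "\<Psi> (b ^ n k)" "G k",
      OF b a _ gap zero one block, folded V_def \<kappa>_def]
    show "V k \<le> \<Psi> (b ^ n k)" "\<kappa> (Suc k) * \<Psi> (b ^ n k) \<le> V k"
      "1 / real b ^ (G k + 1) \<le> V k" "V k \<le> 1 / real b ^ G k"
      using bounds by simp_all
  qed
  have V_pos: "V k > 0" for k
  proof -
    have "0 < 1 / real b ^ (G k + 1)" using b by simp
    then show ?thesis using V(3)[of k] by linarith
  qed
  have approx: "base_value b a * real (b ^ n k) - real_of_int (int (base_prefix b a (n k))) = V k" for k
    using base_value_prefix[of b a "n k", OF b a] unfolding V_def by simp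
  \<comment> \<open>The error is below b^(-n k), so the gap is at least as long as everything before
    it. Hence the block starts at least double, while the words grow only linearly.\<close>
  have G_ge: "n k \<le> G k" for k
  proof -
    have "1 / real b ^ (G k + 1) < 1 / real b ^ n k" using V(1,3)[of k] \<Psi>_less[of k] by linarith
    then have "real b ^ n k < real b ^ (G k + 1)" using b by (simp add: field_simps)
    then show ?thesis using b by (simp add: power_strict_increasing_iff del: power_Suc)
  qed
  have n_ge: "2 ^ k \<le> n k" for k
  proof (induction k)
    case 0
    then show ?case using n\<^sub>0 by (simp add: n_def)
  next
    case (Suc k)
    then show ?case using G_ge[of k] n_Suc[of k] by simp
  qed
  \<comment> \<open>The last digit of a block is 1, so the numerator is 1 modulo b.\<close>
  have cop: "gcd (int (b ^ n (Suc k))) (int (base_prefix b a (n (Suc k)))) = 1" for k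
  proof -
    have "n (Suc k) = Suc (G k + k + 2 + n k)" using n_Suc[of k] by simp
    moreover have "a (G k + k + 2 + n k) = 1"
      using digit[of "G k + k + 2" k] by (simp add: block_word_def Let_def G_def)
    ultimately have "base_prefix b a (n (Suc k)) = b * base_prefix b a (G k + k + 2 + n k) + 1" by simp
    moreover have "coprime b (b * x + 1)" for x :: nat
      by (rule coprimeI) (metis dvd_add_right_iff dvd_mult2)
    ultimately have "coprime (b ^ n (Suc k)) (base_prefix b a (n (Suc k)))" by simp
    then show ?thesis by (simp add: coprime_iff_gcd_eq_1 del: of_nat_power)
  qed
  have abs_eq: "\<bar>base_value b a * real (b ^ n (Suc k)) - real_of_int (int (base_prefix b a (n (Suc k))))\<bar> = V (Suc k)" for k
    unfolding approx using V_pos[of "Suc k"] by simp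
  show ?thesis unfolding a_def[symmetric]
  \<comment> \<open>The start \<open>n 0\<close> is skipped: only zeros precede it, so its numerator
    is 0 and not coprime to the denominator. In \<open>C\<close>, the exponent k + 4 counts the
    digits of block k + 1 after its gap; the gap itself is absorbed by the error.\<close>
  proof (rule exact_approximation_star[where \<zeta> = "base_value b a" and \<epsilon> = \<epsilon> and N = N and q = "\<lambda>k. b ^ n (Suc k)"
        and p = "\<lambda>k. int (base_prefix b a (n (Suc k)))" and \<kappa> = "\<lambda>k. \<kappa> (Suc (Suc k))"
        and C = "\<lambda>k. real b ^ (k + 4)", unfolded abs_eq])
    show "\<And>x. 1 \<le> x \<Longrightarrow> 0 < \<Psi> x" by (rule \<Psi>)
    show "0 < \<epsilon>" by (rule \<epsilon>)
    show "\<And>x. N \<le> x \<Longrightarrow> \<Psi> x < real x powr (- ((1 + sqrt 5) / 2) - \<epsilon>)" by (rule decay)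
    show "1 \<le> b ^ n (Suc k)" for k using b by simp
    show "strict_mono (\<lambda>k. b ^ n (Suc k))"
      using b strict_monoD[OF n_mono] by (intro strict_monoI power_strict_increasing) auto
    show "gcd (int (b ^ n (Suc k))) (int (base_prefix b a (n (Suc k)))) = 1" for k by (rule cop)
    show "0 < V (Suc k)" for k by (rule V_pos)
    show "V (Suc k) \<le> \<Psi> (b ^ n (Suc k))" for k by (rule V)
    show "\<kappa> (Suc (Suc k)) * \<Psi> (b ^ n (Suc k)) \<le> V (Suc k)" for k by (rule V)
    have "(\<lambda>k. 1 / real b ^ Suc (Suc k)) \<longlonglongrightarrow> 0"
    proof -
      have "(\<lambda>k. (1 / real b) ^ k) \<longlonglongrightarrow> 0" using b by (intro LIMSEQ_realpow_zero) auto
      from LIMSEQ_ignore_initial_segment[OF this, of 2] show ?thesis by (simp add: power_one_over)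
    qed
    then have "(\<lambda>k. (1 - 1 / real b ^ Suc (Suc k)) / (1 + real b * (1 / real b ^ Suc (Suc k))) / (real b - 1))
        \<longlonglongrightarrow> (1 - 0) / (1 + real b * 0) / (real b - 1)"
      using b by (intro tendsto_intros) auto
    then show "(\<lambda>k. \<kappa> (Suc (Suc k))) \<longlonglongrightarrow> 1 / (real b - 1)" unfolding \<kappa>_def by simp
    show "1 / (real b - 1) \<le> 1" using b by simp
    show "real (b ^ n (Suc (Suc k))) * V (Suc k) \<le> real b ^ (k + 4) * real (b ^ n (Suc k))" for k
    proof -
      define A where "A = real b ^ (k + 4) * real (b ^ n (Suc k))"
      have eq: "real (b ^ n (Suc (Suc k))) = A * real b ^ G (Suc k)"
        unfolding A_def by (simp add: n_Suc[of "Suc k"] power_add eval_nat_numeral)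
      have "real b ^ G (Suc k) * V (Suc k) \<le> 1" using V(4)[of "Suc k"] b by (simp add: field_simps)
      then have "A * (real b ^ G (Suc k) * V (Suc k)) \<le> A * 1"
        unfolding A_def by (intro mult_left_mono) auto
      then show ?thesis unfolding eq A_def[symmetric] by (simp only: mult.assoc mult_1_right)
    qed
    show "eventually (\<lambda>k. real b ^ (k + 4) \<le> real (b ^ n (Suc k)) powr \<eta>) sequentially" if "\<eta> > 0" for \<eta>
    proof -
      have "eventually (\<lambda>k. real k + 4 \<le> \<eta> * 2 ^ Suc k) sequentially" using that by real_asymp
      then show ?thesis
      proof eventually_elim
        case (elim k)
        have "real (2 ^ Suc k) \<le> real (n (Suc k))" using n_ge[of "Suc k"] by (intro of_nat_mono)
        then have "\<eta> * 2 ^ Suc k \<le> \<eta> * real (n (Suc k))" using that by (intro mult_left_mono) auto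
        then have "real (k + 4) \<le> \<eta> * real (n (Suc k))" using elim by simp
        then have "real b powr real (k + 4) \<le> real b powr (\<eta> * real (n (Suc k)))"
          using b by (intro powr_mono) auto
        moreover have "real b powr (\<eta> * real (n (Suc k))) = real (b ^ n (Suc k)) powr \<eta>"
          using b by (simp add: powr_powr powr_realpow[symmetric] mult.commute)
        moreover have "real b powr real (k + 4) = real b ^ (k + 4)" using b by (intro powr_realpow) auto
        ultimately show ?case by simp
      qed
    qed
  qed
qed

section \<open>Uncountability and conclusion\<close>

text \<open>Equal values have equal digits, and the free digit of block k, at offset G + (k + 1) for
  its gap G, is 1 exactly when k lies in the set.\<close>

lemma block_number_inj:
  assumes b: "b \<ge> 3"
  shows "inj (\<lambda>S. base_value b (block_digit b \<Psi> n\<^sub>0 S))"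
proof (rule injI)
  fix S S' assume eq: "base_value b (block_digit b \<Psi> n\<^sub>0 S) = base_value b (block_digit b \<Psi> n\<^sub>0 S')"
  have dig: "block_digit b \<Psi> n\<^sub>0 S m = block_digit b \<Psi> n\<^sub>0 S' m" for m
    using base_value_inject[of b "block_digit b \<Psi> n\<^sub>0 S" "block_digit b \<Psi> n\<^sub>0 S'"] b eq block_digit_le_1
    by blast
  have "k \<in> T \<longleftrightarrow> block_digit b \<Psi> n\<^sub>0 T (block_gap b (\<Psi> (b ^ block_start b \<Psi> n\<^sub>0 k)) (Suc k) + Suc k
      + block_start b \<Psi> n\<^sub>0 k) = 1" for k T
    by (subst block_digit_eq) (auto simp: block_word_def Let_def)
  then show "S = S'" using dig by (intro set_eqI) simp
qed

text \<open>Cantor's diagonal argument.\<close>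

lemma uncountable_range_inj_nat_set:
  fixes f :: "nat set \<Rightarrow> 'a"
  assumes "inj f"
  shows "uncountable (range f)"
proof
  assume "countable (range f)"
  then have "countable (UNIV :: nat set set)" using assms countable_image_inj_on by blast
  then obtain g :: "nat \<Rightarrow> nat set" where "surj g"
    using uncountable_def[of "UNIV :: nat set set"] by auto
  then have "{x. x \<notin> g x} \<in> range g" by simp
  then show False by blast
qed

theorem theorem2p10:
  fixes b :: nat and \<Psi> :: "nat \<Rightarrow> real"
  assumes b: "b \<ge> 3"
    and pos: "\<forall>x\<ge>1. \<Psi> x > 0"
    and decay: "\<exists>\<epsilon>>0. \<exists>N. \<forall>x\<ge>N. \<Psi> x < real x powr (- ((1 + sqrt 5) / 2) - \<epsilon>)"
  shows "((\<forall>l\<ge>1. \<forall>x\<ge>1. \<Psi> (l * x) \<le> real l * \<Psi> x) \<longrightarrow>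
           uncountable ((K1 \<Psi> - (\<Union>c\<in>{c. c < 1 / (real b - 1)}. K1 (\<lambda>q. c * \<Psi> q))) \<inter> digits01_set b))
       \<and> uncountable ((K1_star \<Psi> - (\<Union>c\<in>{c. c < 1 / (real b - 1)}. K1_star (\<lambda>q. c * \<Psi> q))) \<inter> digits01_set b)"
proof -
  obtain \<epsilon> N where \<epsilon>: "\<epsilon> > 0" and N: "\<And>x. x \<ge> N \<Longrightarrow> \<Psi> x < real x powr (- ((1 + sqrt 5) / 2) - \<epsilon>)"
    using decay by blast
  define E where "E = (K1_star \<Psi> - (\<Union>c\<in>{c. c < 1 / (real b - 1)}. K1_star (\<lambda>q. c * \<Psi> q))) \<inter> digits01_set b"
  define E' where "E' = (K1 \<Psi> - (\<Union>c\<in>{c. c < 1 / (real b - 1)}. K1 (\<lambda>q. c * \<Psi> q))) \<inter> digits01_set b"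
  have "max N 1 < b ^ max N 1" using b by (intro power_gt_expt) auto
  then have "b ^ max N 1 \<ge> N" by linarith
  then have "range (\<lambda>S. base_value b (block_digit b \<Psi> (max N 1) S)) \<subseteq> E"
    unfolding E_def using block_number_exact[of b \<Psi> \<epsilon> N "max N 1"] b pos \<epsilon> N
      base_value_in_digits01_set[OF b, of "block_digit b \<Psi> (max N 1) _", OF block_digit_le_1]
    by (auto simp del: max.bounded_iff)
  moreover have "uncountable (range (\<lambda>S. base_value b (block_digit b \<Psi> (max N 1) S)))"
    by (intro uncountable_range_inj_nat_set block_number_inj b)
  ultimately have E: "uncountable E" using countable_subset by blast
  \<comment> \<open>The same numbers serve for \<open>K1\<close>: the set \<open>K1 \<Psi>\<close>
    is the larger one, and each set removed from it lies in the corresponding \<open>K1_star\<close>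
    set.\<close>
  have "E \<subseteq> E'" if mult: "\<forall>l\<ge>1. \<forall>x\<ge>1. \<Psi> (l * x) \<le> real l * \<Psi> x"
  proof -
    have "K1 (\<lambda>q. c * \<Psi> q) \<subseteq> K1_star (\<lambda>q. c * \<Psi> q)" if c: "c < 1 / (real b - 1)" for c
    proof (cases "c \<ge> 0")
      case True
      have "1 / (real b - 1) \<le> 1" using b by simp
      then have c1: "c \<le> 1" using c by linarith
      show ?thesis
      proof (rule K1_subset_K1_star[where N = "max N 1"])
        show "c * \<Psi> (l * x) \<le> real l * (c * \<Psi> x)" if "l \<ge> 1" "x \<ge> 1" for l x
          using mult_left_mono[OF mult[rule_format, OF that] True] by (simp add: mult.left_commute)
        show "c * \<Psi> x \<le> 1" if x: "x \<ge> max N 1" for x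
        proof -
          have "\<Psi> x < real x powr (- ((1 + sqrt 5) / 2) - \<epsilon>)" using N x by simp
          also have "\<dots> \<le> real x powr 0"
            by (rule powr_mono) (use x \<epsilon> golden_ratio_bounds(1) in \<open>linarith, simp\<close>)
          also have "\<dots> = 1" using x by simp
          finally show ?thesis using True c1 pos x by (intro mult_le_one) (auto intro: less_imp_le)
        qed
      qed
    next
      \<comment> \<open>For negative c the inequality \<open>mult\<close> would be reversed, but no
        pair satisfies the condition at all.\<close>
      case False
      have "{(q :: nat, p :: int). q \<ge> 1 \<and> \<bar>\<zeta> * real q - real_of_int p\<bar> \<le> c * \<Psi> q} = {}" for \<zeta>
      proof -
        have "\<not> \<bar>\<zeta> * real q - real_of_int p\<bar> \<le> c * \<Psi> q" if "q \<ge> 1" for q :: nat and p :: int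
          using mult_neg_pos[of c "\<Psi> q"] pos that False by (auto simp: not_le intro: less_le_trans)
        then show ?thesis by blast
      qed
      then show ?thesis unfolding K1_def by (metis (no_types, lifting) finite.emptyI mem_Collect_eq subsetI)
    qed
    moreover have "K1_star \<Psi> \<subseteq> K1 \<Psi>"
    proof
      fix \<zeta> assume "\<zeta> \<in> K1_star \<Psi>"
      moreover have "{(q :: nat, p :: int). q \<ge> 1 \<and> gcd (int q) p = 1 \<and> \<bar>\<zeta> * real q - real_of_int p\<bar> \<le> \<Psi> q}
        \<subseteq> {(q, p). q \<ge> 1 \<and> \<bar>\<zeta> * real q - real_of_int p\<bar> \<le> \<Psi> q}" by auto
      ultimately show "\<zeta> \<in> K1 \<Psi>" unfolding K1_def K1_star_def using infinite_super by blast
    qed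
    ultimately show ?thesis unfolding E_def E'_def by blast
  qed
  then show ?thesis using E unfolding E_def[symmetric] E'_def[symmetric] by (meson countable_subset)
qed

end
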